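(* One has $h(N)\le N^{1/4+o(1)}$ as $N\to\infty$; that is, for every $\varepsilon>0$ there is $N_0$ such that $h(N)\le N^{1/4+\varepsilon}$ for all integers $N\ge N_0$.
   Context: For a positive integer $N$, let $[N]=\{1,\ldots,N\}$. Let $h(N)$ be the smallest positive integer $r$ such that $[N]$ can be colored with $r$ colors so that every nontrivial $4$-term arithmetic progression $a,a+d,a+2d,a+3d$ (with $d\ne 0$ an integer and all four terms in $[N]$) contains at least three distinct colors. *)

theory Defs
  imports Complex_Main
begin

text \<open>
  Colours are the natural numbers below \<open>r\<close>, and not all of them need be used.  The interval
  \<open>{1..N}\<close> is taken inside the integers so that the common difference may be negative.
\<close>

definition three_coloured_APs :: "nat \<Rightarrow> (int \<Rightarrow> nat) \<Rightarrow> bool" where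
  "three_coloured_APs N c \<longleftrightarrow>
     (\<forall>a d :: int. d \<noteq> 0 \<longrightarrow> {a, a + d, a + 2 * d, a + 3 * d} \<subseteq> {1..int N} \<longrightarrow>
        card {c a, c (a + d), c (a + 2 * d), c (a + 3 * d)} \<ge> 3)"

definition admissible :: "nat \<Rightarrow> nat \<Rightarrow> bool" where
  "admissible N r \<longleftrightarrow> (\<exists>c. c ` {1..int N} \<subseteq> {..<r} \<and> three_coloured_APs N c)"

definition h :: "nat \<Rightarrow> nat" where
  "h N = (LEAST r. r > 0 \<and> admissible N r)"

text \<open>The minimum is attained, since giving all points different colours is admissible.\<close>

lemma admissible_Suc: "admissible N (Suc N)"
proof -
  have "three_coloured_APs N nat"
    unfolding three_coloured_APs_def
  proof (intro allI impI)
    fix a d :: int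
    assume "d \<noteq> 0" and sub: "{a, a + d, a + 2 * d, a + 3 * d} \<subseteq> {1..int N}"
    then have "card {nat a, nat (a + d), nat (a + 2 * d)} = 3"
      by (auto simp: card_insert_if nat_eq_iff)
    moreover have "card {nat a, nat (a + d), nat (a + 2 * d)}
        \<le> card {nat a, nat (a + d), nat (a + 2 * d), nat (a + 3 * d)}"
      by (rule card_mono) auto
    ultimately show "3 \<le> card {nat a, nat (a + d), nat (a + 2 * d), nat (a + 3 * d)}"
      by simp
  qed
  moreover have "nat ` {1..int N} \<subseteq> {..<Suc N}"
    by auto
  ultimately show ?thesis
    unfolding admissible_def by blast
qed

lemma h_pos_admissible: "h N > 0 \<and> admissible N (h N)"
  unfolding h_def by (rule LeastI[of _ "Suc N"]) (simp add: admissible_Suc)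

end

theory Submission
  imports Defs "HOL-Number_Theory.Cong" "HOL-Library.Discrete_Functions" "HOL-Real_Asymp.Real_Asymp"
begin

text \<open>
  Write \<open>x\<close> in base \<open>q\<close>, a large fixed prime, with \<open>4 k\<close> digits. The colour of \<open>x\<close> has three parts.

  The first part records coarse information on every digit, at a cost of \<open>q\<^bsup>o(1)\<^esup>\<close> per digit. It is
  chosen such that as soon as two terms of a four-term progression agree in it, no carries occur:
  the digit vectors of the four terms are \<open>v\<close>, \<open>v + \<delta>\<close>, \<open>v + 2\<delta>\<close>, \<open>v + 3\<delta>\<close> with \<open>\<delta> \<noteq> 0\<close>.

  The second part is the sum of the squares of the digits, as in Behrend's construction. It is a
  strictly convex quadratic function along the progression, so equal values at the positions \<open>i \<noteq> j\<close>
  determine \<open>i + j\<close>. The only pattern with at most two colours that survives is \<open>ABBA\<close>.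

  The third part consists of the \<open>k\<close> values \<open>v\<^sub>0 + C(v\<^sub>1, v\<^sub>2, v\<^sub>3) mod q\<close>, one for each block of four
  digits, where \<open>C\<close> is a cubic form without nontrivial zeros modulo \<open>q\<close>. In the pattern \<open>ABBA\<close> the
  third difference \<open>6 C(\<delta>\<^sub>1, \<delta>\<^sub>2, \<delta>\<^sub>3)\<close> vanishes modulo \<open>q\<close>, hence \<open>\<delta>\<^sub>1 = \<delta>\<^sub>2 = \<delta>\<^sub>3 = 0\<close>, and then
  \<open>3 \<delta>\<^sub>0\<close>, the difference of the outer values, vanishes as well. This part costs \<open>q\<^sup>k\<close>, about \<open>N\<^bsup>1/4\<^esup>\<close>.
\<close>

section \<open>Colourings with values in a finite set\<close>

text \<open>Allows structured colours such as tuples of lists: an injective renaming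
  \<open>g\<close> preserves the number of distinct ones.\<close>

lemma h_le_card:
  assumes "finite S" and S: "\<kappa> ` {1..int N} \<subseteq> S" "S \<noteq> {}"
    and AP: "\<And>a d :: int. d \<noteq> 0 \<Longrightarrow> {a, a + d, a + 2 * d, a + 3 * d} \<subseteq> {1..int N} \<Longrightarrow>
        card {\<kappa> a, \<kappa> (a + d), \<kappa> (a + 2 * d), \<kappa> (a + 3 * d)} \<ge> 3"
  shows "h N \<le> card S"
proof -
  obtain g where g: "bij_betw g S {0..<card S}"
    using ex_bij_betw_finite_nat[OF \<open>finite S\<close>] by blast
  have "three_coloured_APs N (g \<circ> \<kappa>)"
    unfolding three_coloured_APs_def
  proof (intro allI impI)
    fix a d :: int
    assume d: "d \<noteq> 0" and sub: "{a, a + d, a + 2 * d, a + 3 * d} \<subseteq> {1..int N}"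
    let ?T = "{\<kappa> a, \<kappa> (a + d), \<kappa> (a + 2 * d), \<kappa> (a + 3 * d)}"
    have "?T \<subseteq> S"
      using S(1) sub by auto
    then have "card (g ` ?T) = card ?T"
      using g by (intro card_image) (metis bij_betw_def inj_on_subset)
    with AP[OF d sub] show "3 \<le> card {(g \<circ> \<kappa>) a, (g \<circ> \<kappa>) (a + d), (g \<circ> \<kappa>) (a + 2 * d), (g \<circ> \<kappa>) (a + 3 * d)}"
      by simp
  qed
  moreover have "(g \<circ> \<kappa>) ` {1..int N} \<subseteq> {..<card S}"
    using S(1) bij_betw_imp_surj_on[OF g] by fastforce
  ultimately have "admissible N (card S)"
    unfolding admissible_def by blast
  moreover have "card S > 0"
    using S(2) \<open>finite S\<close> by (simp add: card_gt_0_iff)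
  ultimately show ?thesis
    unfolding h_def by (intro Least_le) simp
qed

section \<open>Digits in base \<open>q\<close>\<close>

definition dig :: "int \<Rightarrow> nat \<Rightarrow> int \<Rightarrow> int" where
  "dig q i x = x div q ^ i mod q"

lemma dig_bounds: "q > 0 \<Longrightarrow> 0 \<le> dig q i x \<and> dig q i x < q"
  by (simp add: dig_def)

lemma sum_dig_mod: "q > 0 \<Longrightarrow> (\<Sum>i<n. dig q i x * q ^ i) = x mod q ^ n"
proof (induction n)
  case (Suc n)
  have "x mod q ^ Suc n = q ^ n * (x div q ^ n mod q) + x mod q ^ n"
    using Suc.prems zmod_zmult2_eq[of q x "q ^ n"] by (simp add: mult.commute)
  with Suc show ?case
    by (simp add: dig_def mult.commute)
qed simp

lemma sum_dig: "q > 0 \<Longrightarrow> 0 \<le> x \<Longrightarrow> x < q ^ n \<Longrightarrow> (\<Sum>i<n. dig q i x * q ^ i) = x"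
  by (simp add: sum_dig_mod)

lemma dig_unique:
  assumes "\<And>j. j < n \<Longrightarrow> 0 \<le> w j \<and> w j < q" and "i < n"
  shows "dig q i (\<Sum>j<n. w j * q ^ j) = w i"
  using assms
proof (induction n arbitrary: w i)
  case (Suc n)
  have q: "q > 0" and w0: "0 \<le> w 0" "w 0 < q"
    using Suc.prems(1)[of 0] by auto
  let ?t = "\<Sum>j<n. w (Suc j) * q ^ j"
  have split: "(\<Sum>j<Suc n. w j * q ^ j) = w 0 + q * ?t"
    by (subst sum.lessThan_Suc_shift) (simp add: sum_distrib_left ac_simps)
  show ?case
  proof (cases i)
    case 0
    then show ?thesis
      unfolding split using w0 by (simp add: dig_def)
  next
    case (Suc i')
    have "dig q i (w 0 + q * ?t) = dig q i' ((w 0 + q * ?t) div q)"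
      using q Suc by (simp add: dig_def zdiv_zmult2_eq)
    also have "(w 0 + q * ?t) div q = ?t"
      using w0 q by simp
    also have "dig q i' ?t = w (Suc i')"
      using Suc Suc.prems by (intro Suc.IH) auto
    finally show ?thesis
      using split Suc by simp
  qed
qed simp

section \<open>Localised digits and progressions without carries\<close>

text \<open>
  Equal residues modulo 6 make a difference divisible by 2 and 3; equal dyadic scales of the squared
  distances to both ends of the digit range keep it smaller than half the distance to either end.
\<close>

definition loc :: "int \<Rightarrow> int \<Rightarrow> int \<times> nat \<times> nat" where
  "loc q v = (v mod 6, floor_log (nat (v + 1) ^ 2), floor_log (nat (q - v) ^ 2))"

text \<open>Equal \<open>floor_log\<close> keeps the ratio of the squares below 2, and 2 < 9/4.
  Unsquared, the ratio bound would only be 2, too weak for \<open>loc_eq_imp\<close>.\<close>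

lemma floor_log_square_eq_imp:
  fixes x y :: int
  assumes "floor_log (nat x ^ 2) = floor_log (nat y ^ 2)" "x > 0" "y > 0"
  shows "2 * y < 3 * x"
proof (rule ccontr)
  assume "\<not> ?thesis"
  then have "3 * nat x \<le> 2 * nat y" by linarith
  then have "(3 * nat x)\<^sup>2 \<le> (2 * nat y)\<^sup>2" by (rule power_mono) simp
  then have a: "9 * (nat x)\<^sup>2 \<le> 4 * (nat y)\<^sup>2" by (simp add: power_mult_distrib)
  let ?l = "floor_log (nat x ^ 2)"
  have "2 ^ ?l \<le> (nat x)\<^sup>2"
    using assms by (intro floor_log_exp2_le) simp
  moreover have "(nat y)\<^sup>2 < 2 * 2 ^ ?l"
    using floor_log_exp2_gt[of "(nat y)\<^sup>2"] assms(1) by simp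
  moreover have "(nat x)\<^sup>2 > 0" using assms by simp
  ultimately show False using a by linarith
qed

text \<open>With \<open>v' - v = m * e\<close>, equal scales keep \<open>2 * m * |e|\<close> below
  \<open>v + 1\<close>, \<open>v' + 1\<close>, \<open>q - v\<close> and \<open>q - v'\<close>, so
  two more steps \<open>e\<close> past either value stay in range. This covers all four terms,
  wherever the two agreeing ones sit.\<close>

lemma loc_eq_imp:
  assumes eq: "loc q v = loc q v'" and v: "0 \<le> v" "v < q" "0 \<le> v'" "v' < q"
    and m: "m \<in> {1, 2, 3}" and k: "-2 \<le> k" "k \<le> m + 2"
  shows "m dvd v' - v" "0 \<le> v + k * ((v' - v) div m)" "v + k * ((v' - v) div m) < q"
proof -
  have "6 dvd v' - v"
    using eq by (simp add: loc_def mod_eq_dvd_iff[symmetric])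
  then show m_dvd: "m dvd v' - v"
    using m by (auto intro: dvd_trans[of _ 6])
  define e where "e = (v' - v) div m"
  have e: "v' = v + m * e"
    using m_dvd by (simp add: e_def)
  have "2 * (v' + 1) < 3 * (v + 1)" "2 * (v + 1) < 3 * (v' + 1)"
    "2 * (q - v') < 3 * (q - v)" "2 * (q - v) < 3 * (q - v')"
    by (intro floor_log_square_eq_imp; use eq v in \<open>simp add: loc_def\<close>)+
  moreover have "k \<in> {-2, -1, 0, 1, 2, 3, 4, 5}"
    using k m by auto
  ultimately have "0 \<le> v + k * e \<and> v + k * e < q"
    using m k v e by (elim insertE emptyE) simp_all
  then show "0 \<le> v + k * ((v' - v) div m)" "v + k * ((v' - v) div m) < q"
    by (simp_all add: e_def)
qed

text \<open>Dividing the digit differences by \<open>m\<close> expands \<open>d\<close> with signed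
  digits \<open>\<delta> i\<close>; the sums with the digits of \<open>y\<close> stay in range, so
  uniqueness of digits excludes carries.\<close>

lemma digits_AP:
  assumes q: "q > 0" and m: "m \<in> {1, 2, 3}"
    and y: "0 \<le> y" "y < q ^ n" "0 \<le> y + m * d" "y + m * d < q ^ n"
    and eq: "\<And>i. i < n \<Longrightarrow> loc q (dig q i y) = loc q (dig q i (y + m * d))"
  obtains \<delta> where "\<And>i k. i < n \<Longrightarrow> -2 \<le> k \<Longrightarrow> k \<le> m + 2 \<Longrightarrow> dig q i (y + k * d) = dig q i y + k * \<delta> i"
proof -
  define \<delta> where "\<delta> i = (dig q i (y + m * d) - dig q i y) div m" for i
  note L = loc_eq_imp[OF eq conjunct1[OF dig_bounds[OF q]] conjunct2[OF dig_bounds[OF q]]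
      conjunct1[OF dig_bounds[OF q]] conjunct2[OF dig_bounds[OF q]] m, folded \<delta>_def]
  have step: "dig q i (y + m * d) - dig q i y = m * \<delta> i" if "i < n" for i
    using L(1)[OF that, of 0] m by (auto simp: \<delta>_def)
  have "m * d = (\<Sum>i<n. dig q i (y + m * d) * q ^ i) - (\<Sum>i<n. dig q i y * q ^ i)"
    using q y by (simp add: sum_dig)
  also have "\<dots> = (\<Sum>i<n. m * (\<delta> i * q ^ i))"
    unfolding sum_subtractf[symmetric]
    using step by (intro sum.cong refl) (simp add: left_diff_distrib[symmetric] mult.assoc)
  finally have d: "d = (\<Sum>i<n. \<delta> i * q ^ i)"
    using m by (auto simp: sum_distrib_left[symmetric])
  show ?thesis
  proof (rule that)
    fix i k assume i: "i < n" and k: "-2 \<le> k" "k \<le> m + 2"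
    have "y + k * d = (\<Sum>i<n. dig q i y * q ^ i) + k * (\<Sum>i<n. \<delta> i * q ^ i)"
      using q y by (simp add: sum_dig d[symmetric])
    also have "\<dots> = (\<Sum>i<n. (dig q i y + k * \<delta> i) * q ^ i)"
      by (simp add: sum_distrib_left sum.distrib algebra_simps)
    finally show "dig q i (y + k * d) = dig q i y + k * \<delta> i"
      using L(2,3) k i by (simp add: dig_unique)
  qed
qed

section \<open>A cubic form without nontrivial zeros modulo a prime\<close>

text \<open>
  The norm of \<open>u + v \<theta> + w \<theta>\<^sup>2\<close>, where \<open>\<theta>\<^sup>3 = \<theta> + a\<close>.
\<close>

definition cub :: "int \<Rightarrow> int \<Rightarrow> int \<Rightarrow> int \<Rightarrow> int" where
  "cub a u v w = u * (u + w)\<^sup>2 - u * v\<^sup>2 - 3 * a * u * v * w + a * v ^ 3 + a\<^sup>2 * w ^ 3 - a * v * w\<^sup>2"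

text \<open>Eliminates the base point, so that values along a progression constrain its step
  alone.\<close>

lemma cub_third_difference:
  "cub a (u + 3 * r) (v + 3 * s) (w + 3 * t) - 3 * cub a (u + 2 * r) (v + 2 * s) (w + 2 * t)
     + 3 * cub a (u + r) (v + s) (w + t) - cub a u v w = 6 * cub a r s t"
  by (simp add: cub_def algebra_simps power2_eq_square power3_eq_cube)

lemma ex_solution:
  fixes q x y :: int
  assumes "prime q" "\<not> q dvd x"
  obtains r where "q dvd x * r - y"
proof -
  have "coprime x q"
    using assms by (simp add: coprime_commute prime_imp_coprime)
  then obtain z where "[x * z = 1] (mod q)"
    using cong_solve_coprime_int by blast
  then have "q dvd (x * z - 1) * y"
    by (simp add: cong_iff_dvd_diff)
  then have "q dvd x * (z * y) - y"
    by (simp add: algebra_simps)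
  then show ?thesis by (rule that)
qed

text \<open>The map \<open>r ^ 3 - r\<close> on residues sends both 0 and 1 to 0, so on a finite set
  it also misses some value \<open>a\<close>.\<close>

lemma ex_irreducible_cubic:
  fixes q :: int
  assumes "prime q"
  obtains a where "\<And>r. \<not> q dvd r ^ 3 - r - a"
proof -
  have q: "q > 1"
    using assms prime_gt_1_int by blast
  let ?g = "\<lambda>r::int. (r ^ 3 - r) mod q"
  have "\<not> inj_on ?g {0..<q}"
  proof
    assume "inj_on ?g {0..<q}"
    from inj_onD[OF this, of 0 1] show False
      using q by simp
  qed
  then have "\<not> {0..<q} \<subseteq> ?g ` {0..<q}"
    using finite_surj_inj[of "{0..<q}" ?g] by blast
  then obtain a where a: "a \<in> {0..<q}" "a \<notin> ?g ` {0..<q}"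
    by blast
  show ?thesis
  proof (rule that[of a])
    fix r
    show "\<not> q dvd r ^ 3 - r - a"
    proof
      assume "q dvd r ^ 3 - r - a"
      then have "?g r = a mod q"
        using mod_eq_dvd_iff by blast
      moreover have "?g (r mod q) = ?g r"
        by (intro mod_diff_cong) (simp_all add: power_mod)
      ultimately have "a = ?g (r mod q)"
        using a(1) by simp
      moreover have "r mod q \<in> {0..<q}"
        using q by simp
      ultimately have "a \<in> ?g ` {0..<q}"
        by (rule image_eqI)
      with a(2) show False ..
    qed
  qed
qed

lemma cub_anisotropic:
  fixes q :: int
  assumes q: "prime q" and a: "\<And>r. \<not> q dvd r ^ 3 - r - a" and C: "q dvd cub a u v w"
  shows "q dvd u \<and> q dvd v \<and> q dvd w"
proof -
  have w: "q dvd w"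
  proof (rule ccontr)
    assume nw: "\<not> q dvd w"
    \<comment> \<open>\<open>R\<^sub>1 X + R\<^sub>0\<close> is the remainder of \<open>w\<^sup>2 (X\<^sup>3 - X - a)\<close> modulo \<open>w X\<^sup>2 + v X + u\<close>, and the two
      polynomials have resultant \<open>cub a u v w\<close> up to a power of \<open>w\<close>; if it vanishes, their
      common factor yields a root \<open>r\<close> of the cubic.\<close>
    define R\<^sub>1 R\<^sub>0 where "R\<^sub>1 = v\<^sup>2 - u * w - w\<^sup>2" and "R\<^sub>0 = u * v - a * w\<^sup>2"
    have "w\<^sup>2 * cub a u v w = w * R\<^sub>0\<^sup>2 - v * R\<^sub>0 * R\<^sub>1 + u * R\<^sub>1\<^sup>2"
      by (simp add: cub_def R\<^sub>1_def R\<^sub>0_def algebra_simps power2_eq_square power3_eq_cube)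
    then have res: "q dvd w * R\<^sub>0\<^sup>2 - v * R\<^sub>0 * R\<^sub>1 + u * R\<^sub>1\<^sup>2"
      using C by (metis dvd_mult)
    have division: "w\<^sup>2 * (r ^ 3 - r - a) = (w * r - v) * (w * r\<^sup>2 + v * r + u) + (R\<^sub>1 * r + R\<^sub>0)" for r
      by (simp add: R\<^sub>1_def R\<^sub>0_def algebra_simps power2_eq_square power3_eq_cube)
    show False
    proof (cases "q dvd R\<^sub>1")
      case True
      with res have "q dvd w * R\<^sub>0\<^sup>2"
        by (metis dvd_add_left_iff dvd_diff_left_iff dvd_mult power2_eq_square)
      then have "q dvd R\<^sub>0"
        using q nw by (simp add: prime_dvd_mult_iff prime_dvd_power_iff)
      \<comment> \<open>The remainder vanishes identically, so a root of the cofactor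
        \<open>w X - v\<close> is a root of the cubic.\<close>
      obtain r where "q dvd w * r - v"
        using ex_solution[OF q nw] .
      then have "q dvd w\<^sup>2 * (r ^ 3 - r - a)"
        using True \<open>q dvd R\<^sub>0\<close> unfolding division by (intro dvd_add dvd_mult2)
      then show False
        using a q nw by (simp add: prime_dvd_mult_iff prime_dvd_power_iff)
    next
      case False
      obtain r where r: "q dvd R\<^sub>1 * r - (- R\<^sub>0)"
        using ex_solution[OF q False] .
      have "R\<^sub>1\<^sup>2 * (w * r\<^sup>2 + v * r + u) = (w * R\<^sub>0\<^sup>2 - v * R\<^sub>0 * R\<^sub>1 + u * R\<^sub>1\<^sup>2)
          + (R\<^sub>1 * r - (- R\<^sub>0)) * (w * (R\<^sub>1 * r - R\<^sub>0) + v * R\<^sub>1)"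
        by (simp add: algebra_simps power2_eq_square)
      then have "q dvd R\<^sub>1\<^sup>2 * (w * r\<^sup>2 + v * r + u)"
        using r res by (metis dvd_add dvd_mult2)
      then have "q dvd w * r\<^sup>2 + v * r + u"
        using q False by (simp add: prime_dvd_mult_iff prime_dvd_power_iff)
      then have "q dvd w\<^sup>2 * (r ^ 3 - r - a)"
        using dvd_add[OF dvd_mult r] unfolding division by simp
      then show False
        using a q nw by (simp add: prime_dvd_mult_iff prime_dvd_power_iff)
    qed
  qed
  \<comment> \<open>Modulo \<open>w\<close> the form is \<open>- (v ^ 3)\<close> times the cubic at
    \<open>- u / v\<close>, so \<open>v\<close> invertible would again give a root.\<close>
  have "cub a u v w = (u ^ 3 - u * v\<^sup>2 + a * v ^ 3) + w * (2 * u\<^sup>2 + u * w - 3 * a * u * v + a\<^sup>2 * w\<^sup>2 - a * v * w)"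
    by (simp add: cub_def algebra_simps power2_eq_square power3_eq_cube)
  with C w have C': "q dvd u ^ 3 - u * v\<^sup>2 + a * v ^ 3"
    by (metis dvd_add_left_iff dvd_mult2)
  have v: "q dvd v"
  proof (rule ccontr)
    assume nv: "\<not> q dvd v"
    obtain r where r: "q dvd v * r - (- u)"
      using ex_solution[OF q nv] .
    have "v ^ 3 * (r ^ 3 - r - a) = (v * r - (- u)) * ((v * r)\<^sup>2 - v * r * u + u\<^sup>2 - v\<^sup>2)
        - (u ^ 3 - u * v\<^sup>2 + a * v ^ 3)"
      by (simp add: algebra_simps power2_eq_square power3_eq_cube)
    then have "q dvd v ^ 3 * (r ^ 3 - r - a)"
      using r C' by (metis dvd_diff dvd_mult2)
    then show False
      using a q nv by (simp add: prime_dvd_mult_iff prime_dvd_power_iff)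
  qed
  have "q dvd a * v ^ 3 - u * v\<^sup>2"
    using v by (simp add: power2_eq_square power3_eq_cube)
  with C' have "q dvd (u ^ 3 - u * v\<^sup>2 + a * v ^ 3) - (a * v ^ 3 - u * v\<^sup>2)"
    by (rule dvd_diff)
  then have "q dvd u"
    using q by (simp add: prime_dvd_power_iff)
  with v w show ?thesis by simp
qed

section \<open>The colouring and its four-term progressions\<close>

text \<open>The sum of squares is not reduced modulo \<open>q\<close>, since convexity needs exact
  integers.\<close>

definition colour :: "int \<Rightarrow> int \<Rightarrow> nat \<Rightarrow> int \<Rightarrow> (int \<times> nat \<times> nat) list \<times> int list \<times> int" where
  "colour a q k x =
     (map (\<lambda>i. loc q (dig q i x)) [0..<4 * k],
      map (\<lambda>b. (dig q (4 * b) x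
        + cub a (dig q (4 * b + 1) x) (dig q (4 * b + 2) x) (dig q (4 * b + 3) x)) mod q) [0..<k],
      \<Sum>i<4 * k. (dig q i x)\<^sup>2)"

lemma colour_eq_imp_digits_AP:
  assumes q: "q > 0" and ij: "0 \<le> i" "i < j" "j \<le> 3"
    and x: "\<And>l. 0 \<le> l \<Longrightarrow> l \<le> 3 \<Longrightarrow> 0 \<le> x + l * d \<and> x + l * d < q ^ (4 * k)"
    and eq: "colour a q k (x + i * d) = colour a q k (x + j * d)"
  obtains \<delta> where "\<And>n l. n < 4 * k \<Longrightarrow> 0 \<le> l \<Longrightarrow> l \<le> 3 \<Longrightarrow> dig q n (x + l * d) = dig q n x + l * \<delta> n"
proof -
  have j: "x + j * d = (x + i * d) + (j - i) * d"
    by (simp add: algebra_simps)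
  have m: "j - i \<in> {1, 2, 3}"
    using ij by auto
  have "loc q (dig q n (x + i * d)) = loc q (dig q n ((x + i * d) + (j - i) * d))" if "n < 4 * k" for n
    using eq that unfolding j[symmetric] by (simp add: colour_def)
  then obtain \<delta> where \<delta>: "\<And>n l. n < 4 * k \<Longrightarrow> -2 \<le> l \<Longrightarrow> l \<le> j - i + 2 \<Longrightarrow>
      dig q n ((x + i * d) + l * d) = dig q n (x + i * d) + l * \<delta> n"
    using digits_AP[OF q m, of "x + i * d" "4 * k" d] x[of i] x[of j] ij unfolding j[symmetric] by auto
  have shift: "(x + i * d) + (l - i) * d = x + l * d" for l
    by (simp add: algebra_simps)
  \<comment> \<open>As \<open>i \<le> 2\<close> and \<open>j \<ge> 1\<close>, the offset
    \<open>l - i\<close> lies between -2 and \<open>j - i + 2\<close>.\<close>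
  have dig_l: "dig q n (x + l * d) = dig q n (x + i * d) + (l - i) * \<delta> n" if "n < 4 * k" "0 \<le> l" "l \<le> 3" for n l
    using \<delta>[of n "l - i"] ij that unfolding shift by simp
  have "dig q n (x + l * d) = dig q n x + l * \<delta> n" if "n < 4 * k" "0 \<le> l" "l \<le> 3" for n l
    using dig_l[of n 0] dig_l[of n l] that by (simp add: left_diff_distrib)
  then show ?thesis
    by (rule that)
qed

text \<open>With at most two classes on four positions, either three positions agree or they split
  into two equal pairs.\<close>

lemma card_lt_3_cases:
  assumes "\<not> 3 \<le> card {w, x, y, z}"
  shows "w = x \<and> w = y \<or> w = x \<and> w = z \<or> w = y \<and> w = z \<or> x = y \<and> x = z \<or>
    w = x \<and> y = z \<or> w = y \<and> x = z \<or> w = z \<and> x = y"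
  using assms by (auto simp: card_insert_if split: if_splits)

lemma colour_AP:
  assumes q: "prime q" "q > 3" and a: "\<And>r. \<not> q dvd r ^ 3 - r - a" and d: "d \<noteq> 0"
    and bounds: "\<And>l. 0 \<le> l \<Longrightarrow> l \<le> 3 \<Longrightarrow> 0 \<le> x + l * d \<and> x + l * d < q ^ (4 * k)"
  shows "3 \<le> card {colour a q k x, colour a q k (x + d), colour a q k (x + 2 * d), colour a q k (x + 3 * d)}"
proof (rule ccontr)
  define c where "c l = colour a q k (x + l * d)" for l
  assume "\<not> ?thesis"
  then have "\<not> 3 \<le> card {c 0, c 1, c 2, c 3}"
    by (simp add: c_def)
  note cases = card_lt_3_cases[OF this]
  have q0: "q > 0" using q by simp
  have "\<exists>i\<in>{0, 1, 2}. \<exists>j\<in>{1, 2, 3}. i < j \<and> c i = c j"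
    using cases by auto
  then obtain i j where "i \<in> {0, 1, 2}" "j \<in> {1, 2, 3}" "i < j" "c i = c j"
    by blast
  moreover from this have "0 \<le> i" "j \<le> 3"
    by auto
  ultimately obtain \<delta> where \<delta>: "\<And>n l. n < 4 * k \<Longrightarrow> 0 \<le> l \<Longrightarrow> l \<le> 3 \<Longrightarrow> dig q n (x + l * d) = dig q n x + l * \<delta> n"
    using colour_eq_imp_digits_AP[OF q0 _ _ _ bounds, of i j] unfolding c_def by blast
  define v where "v n = dig q n x" for n
  note \<delta> = \<delta>[folded v_def]
  have "\<exists>n<4 * k. \<delta> n \<noteq> 0"
  proof (rule ccontr)
    assume "\<not> ?thesis"
    then have "dig q n (x + d) = dig q n x" if "n < 4 * k" for n
      using \<delta>[of n 1] that by (simp add: v_def)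
    then have "(\<Sum>n<4 * k. dig q n (x + d) * q ^ n) = (\<Sum>n<4 * k. dig q n x * q ^ n)"
      by simp
    then show False
      using bounds[of 0] bounds[of 1] q0 d by (simp add: sum_dig)
  qed
  then obtain n where n: "n < 4 * k" "\<delta> n \<noteq> 0"
    by blast
  \<comment> \<open>Equality at \<open>i \<noteq> j\<close> forces
    \<open>2 * Q + (i + j) * R = 0\<close>. As \<open>R > 0\<close>, all equal pairs share one sum
    \<open>i + j\<close>, which leaves only 0 + 3 = 1 + 2.\<close>
  have c03: "c 0 = c 3 \<and> c 1 = c 2"
  proof -
    define P Q R where "P = (\<Sum>n<4 * k. (v n)\<^sup>2)" and "Q = (\<Sum>n<4 * k. v n * \<delta> n)" and "R = (\<Sum>n<4 * k. (\<delta> n)\<^sup>2)"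
    have "snd (snd (c l)) = P + 2 * l * Q + l\<^sup>2 * R" if "0 \<le> l" "l \<le> 3" for l
    proof -
      have "snd (snd (c l)) = (\<Sum>n<4 * k. (v n + l * \<delta> n)\<^sup>2)"
        using \<delta> that by (simp add: c_def colour_def)
      also have "\<dots> = P + 2 * l * Q + l\<^sup>2 * R"
        by (simp add: P_def Q_def R_def power2_sum sum.distrib sum_distrib_left power_mult_distrib ac_simps)
      finally show ?thesis .
    qed
    from this[of 0] this[of 1] this[of 2] this[of 3]
    have "snd (snd (c 0)) = P" "snd (snd (c 1)) = P + 2 * Q + R"
      "snd (snd (c 2)) = P + 4 * Q + 4 * R" "snd (snd (c 3)) = P + 6 * Q + 9 * R"
      by simp_all
    moreover have "R > 0"
      unfolding R_def using n by (intro sum_pos2[of _ n]) auto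
    ultimately show ?thesis
      using cases by (elim disjE conjE) auto
  qed
  define b where "b = n div 4"
  have b: "b < k"
    using n by (auto simp: b_def)
  define F where "F l = v (4 * b) + l * \<delta> (4 * b) + cub a (v (4 * b + 1) + l * \<delta> (4 * b + 1))
      (v (4 * b + 2) + l * \<delta> (4 * b + 2)) (v (4 * b + 3) + l * \<delta> (4 * b + 3))" for l
  have F: "fst (snd (c l)) ! b = F l mod q" if "0 \<le> l" "l \<le> 3" for l
    using \<delta>[of _ l] that b by (simp add: c_def colour_def F_def)
  have dvd: "q dvd F 3 - F 0" "q dvd F 2 - F 1"
    using c03 F[of 0] F[of 1] F[of 2] F[of 3] by (simp_all add: mod_eq_dvd_iff[symmetric])
  \<comment> \<open>The linear term of \<open>F\<close> cancels, contributing
    \<open>3 * \<delta> (4 * b) - 3 * \<delta> (4 * b)\<close>.\<close>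
  have "(F 3 - F 0) - 3 * (F 2 - F 1) = 6 * cub a (\<delta> (4 * b + 1)) (\<delta> (4 * b + 2)) (\<delta> (4 * b + 3))"
    using cub_third_difference[of a "v (4 * b + 1)" "\<delta> (4 * b + 1)" "v (4 * b + 2)" "\<delta> (4 * b + 2)"
        "v (4 * b + 3)" "\<delta> (4 * b + 3)"]
    by (simp add: F_def)
  then have "q dvd 6 * cub a (\<delta> (4 * b + 1)) (\<delta> (4 * b + 2)) (\<delta> (4 * b + 3))"
    using dvd by (metis dvd_diff dvd_mult)
  moreover have small: "\<not> q dvd 2" "\<not> q dvd 3"
    using q by (auto dest: zdvd_imp_le)
  then have "\<not> q dvd 6"
    using prime_dvd_multD[OF q(1), of 2 3] by auto
  ultimately have "q dvd \<delta> (4 * b + 1) \<and> q dvd \<delta> (4 * b + 2) \<and> q dvd \<delta> (4 * b + 3)"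
    using q(1) by (intro cub_anisotropic[OF q(1) a]) (metis prime_dvd_mult_iff)
  moreover have zero: "\<delta> m = 0" if "m < 4 * k" "q dvd \<delta> m" for m
  proof -
    have "\<bar>\<delta> m\<bar> < q"
      using \<delta>[of m 1] that dig_bounds[OF q0, of m x] dig_bounds[OF q0, of m "x + d"]
      by (simp add: v_def abs_less_iff)
    then show ?thesis
      using that(2) dvd_imp_le_int[of "\<delta> m" q] by auto
  qed
  ultimately have \<delta>123: "\<delta> (4 * b + 1) = 0" "\<delta> (4 * b + 2) = 0" "\<delta> (4 * b + 3) = 0"
    using b by simp_all
  \<comment> \<open>The cubic part of \<open>F\<close> is now constant in \<open>l\<close>.\<close>
  then have "q dvd 3 * \<delta> (4 * b)"
    using dvd(1) by (simp add: F_def)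
  then have "q dvd \<delta> (4 * b)"
    using q(1) small by (metis prime_dvd_mult_iff)
  then have "\<delta> (4 * b) = 0"
    using b zero by simp
  moreover have "n = 4 * b \<or> n = 4 * b + 1 \<or> n = 4 * b + 2 \<or> n = 4 * b + 3"
    unfolding b_def by presburger
  ultimately show False
    using n(2) \<delta>123 by auto
qed

section \<open>Counting colours and choosing parameters\<close>

lemma h_le:
  assumes p: "prime p" "p > 3" and N: "N < p ^ (4 * k)"
  shows "h N \<le> (6 * (floor_log (p ^ 2) + 1) ^ 2) ^ (4 * k) * (p ^ k * (4 * k * p ^ 2 + 1))"
proof -
  define q where "q = int p"
  have q: "prime q" "q > 3"
    using p by (simp_all add: q_def)
  obtain a where a: "\<And>r. \<not> q dvd r ^ 3 - r - a"
    using ex_irreducible_cubic[OF q(1)] by blast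
  have q0: "q > 0" using q by simp
  let ?f = "floor_log (p ^ 2)"
  define L where "L = {0..<6::int} \<times> {..?f} \<times> {..?f}"
  have L: "finite L" "card L = 6 * (?f + 1) ^ 2"
    by (simp_all add: L_def power2_eq_square)
  define S where "S = {xs. set xs \<subseteq> L \<and> length xs = 4 * k} \<times>
      ({ys. set ys \<subseteq> {0..<q} \<and> length ys = k} \<times> {0..int (4 * k * p ^ 2)})"
  have fin: "finite S"
    unfolding S_def using L(1) by (intro finite_cartesian_product finite_lists_length_eq) auto
  have "card {0..int (4 * k * p ^ 2)} = 4 * k * p ^ 2 + 1"
    unfolding card_atLeastAtMost_int by linarith
  then have card: "card S = (6 * (?f + 1) ^ 2) ^ (4 * k) * (p ^ k * (4 * k * p ^ 2 + 1))"
    unfolding S_def card_cartesian_product by (simp only: card_lists_length_eq L finite_atLeastLessThan_int) (simp add: q_def)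
  have "loc q (dig q i x) \<in> L" for i x
  proof -
    have "nat (dig q i x + 1) ^ 2 \<le> p ^ 2" "nat (q - dig q i x) ^ 2 \<le> p ^ 2"
      using dig_bounds[OF q0, of i x] by (auto intro!: power_mono simp: q_def)
    then show ?thesis
      by (simp add: loc_def L_def floor_log_le_iff)
  qed
  moreover have "(\<Sum>i<4 * k. (dig q i x)\<^sup>2) \<le> int (4 * k * p ^ 2)" for x
  proof -
    have "(\<Sum>i<4 * k. (dig q i x)\<^sup>2) \<le> of_nat (card {..<4 * k}) * q\<^sup>2"
      using dig_bounds[OF q0] by (intro sum_bounded_above power_mono) (auto simp: less_imp_le)
    then show ?thesis by (simp add: q_def)
  qed
  ultimately have mem: "colour a q k x \<in> S" for x
    using q0 by (auto simp: colour_def S_def sum_nonneg)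
  have "h N \<le> card S"
  proof (rule h_le_card[OF fin])
    show "colour a q k ` {1..int N} \<subseteq> S" "S \<noteq> {}"
      using mem by auto
    fix x d :: int
    assume d: "d \<noteq> 0" and sub: "{x, x + d, x + 2 * d, x + 3 * d} \<subseteq> {1..int N}"
    have N': "int N < q ^ (4 * k)"
      using N by (simp add: q_def flip: of_nat_power)
    have "0 \<le> x + l * d \<and> x + l * d < q ^ (4 * k)" if "0 \<le> l" "l \<le> 3" for l
    proof -
      have "l \<in> {0, 1, 2, 3}" using that by auto
      then show ?thesis using sub N' by auto
    qed
    then show "3 \<le> card {colour a q k x, colour a q k (x + d), colour a q k (x + 2 * d), colour a q k (x + 3 * d)}"
      by (rule colour_AP[OF q a d])
  qed
  then show ?thesis by (simp only: card)
qed

text \<open>The cost of \<open>loc\<close> per digit is polylogarithmic in \<open>p\<close>, hence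
  below any fixed power of a large prime.\<close>

lemma ex_prime_base:
  fixes \<eta> :: real
  assumes "\<eta> > 0"
  obtains p :: nat where "prime p" "p > 3" "real (6 * (floor_log (p ^ 2) + 1) ^ 2) \<le> real p powr \<eta>"
proof -
  have "eventually (\<lambda>x::real. 6 * (2 * log 2 x + 1) ^ 2 \<le> x powr \<eta>) at_top"
    using assms by real_asymp
  then obtain X where X: "\<And>x. x \<ge> X \<Longrightarrow> 6 * (2 * log 2 x + 1) ^ 2 \<le> x powr \<eta>"
    by (auto simp: eventually_at_top_linorder)
  obtain p :: nat where p: "prime p" "p > max 3 (nat \<lceil>X\<rceil>)"
    using bigger_prime by blast
  have "2 ^ floor_log (p\<^sup>2) \<le> p\<^sup>2"
    using p by (intro floor_log_exp2_le) simp
  then have "(2::real) ^ floor_log (p\<^sup>2) \<le> real p ^ 2"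
    by (metis of_nat_le_iff of_nat_numeral of_nat_power)
  then have "real (floor_log (p\<^sup>2)) \<le> log 2 (real p ^ 2)"
    by (intro le_log_of_power) simp_all
  also have "\<dots> = 2 * log 2 (real p)"
    using p by (simp add: log_nat_power)
  finally have "(real (floor_log (p\<^sup>2)) + 1) ^ 2 \<le> (2 * log 2 (real p) + 1) ^ 2"
    by (intro power_mono) simp_all
  then have "real (6 * (floor_log (p ^ 2) + 1) ^ 2) \<le> 6 * (2 * log 2 (real p) + 1) ^ 2"
    by (simp add: add.commute)
  also have "\<dots> \<le> real p powr \<eta>"
    using p by (intro X) linarith
  finally show ?thesis
    using p that by auto
qed

theorem corollary1p3:
  shows "\<forall>\<epsilon>::real. \<epsilon> > 0 \<longrightarrow>
    (\<exists>N\<^sub>0::nat. \<forall>N::nat. N \<ge> N\<^sub>0 \<longrightarrow> real (h N) \<le> real N powr (1/4 + \<epsilon>))"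
proof (intro allI impI)
  fix \<epsilon> :: real
  assume "\<epsilon> > 0"
  \<comment> \<open>One half of \<open>\<epsilon>\<close> pays for \<open>loc\<close> on the digits,
    the other for \<open>A\<close> and the factor linear in \<open>k\<close>.\<close>
  define \<eta> where "\<eta> = \<epsilon> / 2"
  have \<eta>: "\<eta> > 0" "\<epsilon> = \<eta> + \<eta>"
    using \<open>\<epsilon> > 0\<close> by (simp_all add: \<eta>_def)
  obtain p :: nat where p: "prime p" "p > 3" "real (6 * (floor_log (p ^ 2) + 1) ^ 2) \<le> real p powr \<eta>"
    using ex_prime_base[OF \<eta>(1)] .
  \<comment> \<open>Pays for rounding \<open>N\<close> up to a power of \<open>p ^ 4\<close>, which
    costs at most a factor \<open>p ^ 4\<close>.\<close>
  define A where "A = (real p ^ 4) powr (1 / 4 + \<eta>)"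
  have A: "A > 0"
    using p by (simp add: A_def)
  have "eventually (\<lambda>x::real. A * (4 * (log 2 x + 1) * real p ^ 2 + 1) \<le> x powr \<eta>) at_top"
    using \<eta>(1) A p(2) by real_asymp
  then obtain X where X: "\<And>x. x \<ge> X \<Longrightarrow> A * (4 * (log 2 x + 1) * real p ^ 2 + 1) \<le> x powr \<eta>"
    by (auto simp: eventually_at_top_linorder)
  have "real (h N) \<le> real N powr (1 / 4 + \<epsilon>)" if N: "N \<ge> max 1 (nat \<lceil>X\<rceil>)" for N
  proof -
    have log_N: "0 \<le> log 2 (real N)"
      using N by simp
    have "2 \<le> p ^ 4"
      using p power_increasing[of 1 4 p] by simp
    then obtain k' where k': "(p ^ 4) ^ k' \<le> N" "N < (p ^ 4) ^ (k' + 1)"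
      using ex_power_ivl1[of "p ^ 4" N] N by auto
    define k where "k = k' + 1"
    define M where "M = real p ^ (4 * k)"
    have "N < p ^ (4 * k)"
      using k'(2) unfolding k_def power_mult .
    from h_le[OF p(1,2) this]
    have "real (h N) \<le> real ((6 * (floor_log (p ^ 2) + 1) ^ 2) ^ (4 * k) * (p ^ k * (4 * k * p ^ 2 + 1)))"
      by (simp only: of_nat_le_iff)
    also have "\<dots> = real (6 * (floor_log (p ^ 2) + 1) ^ 2) ^ (4 * k) * (real p ^ k * (4 * real k * real p ^ 2 + 1))"
      by (simp only: of_nat_mult of_nat_power of_nat_add of_nat_numeral of_nat_1)
    also have "\<dots> \<le> (real p powr \<eta>) ^ (4 * k) * (real p ^ k * (4 * real k * real p ^ 2 + 1))"
      using p(3) by (intro mult_right_mono power_mono) simp_all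
    also have "\<dots> = M powr (1 / 4 + \<eta>) * (4 * real k * real p ^ 2 + 1)"
    proof -
      have pow: "x ^ n = x powr real n" if "x > 0" for x :: real and n
        using that by (simp add: powr_realpow)
      have "(real p powr \<eta>) ^ (4 * k) = real p powr (\<eta> * real (4 * k))"
        using p by (simp only: pow powr_gt_zero powr_powr)
      moreover have "real p ^ k = real p powr (real k)"
        using p by (intro pow) simp
      moreover have "M = real p powr (real (4 * k))"
        unfolding M_def using p by (intro pow) simp
      ultimately have "(real p powr \<eta>) ^ (4 * k) * real p ^ k = M powr (1 / 4 + \<eta>)"
        by (simp add: powr_powr flip: powr_add) (simp add: algebra_simps)
      then show ?thesis
        by (simp only: mult.assoc[symmetric])
    qed
    also have "\<dots> \<le> (real N * real p ^ 4) powr (1 / 4 + \<eta>) * (4 * (log 2 (real N) + 1) * real p ^ 2 + 1)"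
    proof (intro mult_mono powr_mono2 add_mono mult_right_mono mult_left_mono)
      have "M = real ((p ^ 4) ^ k') * real p ^ 4"
        by (simp add: M_def k_def power_mult power_add)
      then show "M \<le> real N * real p ^ 4"
        using k'(1) by (metis mult_right_mono of_nat_0_le_iff of_nat_le_iff zero_le_power)
      have "2 ^ k' \<le> (p ^ 4) ^ k'"
        using \<open>2 \<le> p ^ 4\<close> by (intro power_mono) auto
      then have "real (2 ^ k') \<le> real N"
        using k'(1) unfolding of_nat_le_iff by (rule order_trans)
      then have "2 ^ k' \<le> real N"
        unfolding of_nat_power of_nat_numeral .
      then have "real k' \<le> log 2 (real N)"
        by (intro le_log_of_power) simp_all
      then show "real k \<le> log 2 (real N) + 1"
        by (simp add: k_def)
    qed (use \<eta> log_N in \<open>simp_all add: M_def\<close>)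
    also have "\<dots> = real N powr (1 / 4 + \<eta>) * (A * (4 * (log 2 (real N) + 1) * real p ^ 2 + 1))"
      by (simp add: A_def powr_mult)
    also have "\<dots> \<le> real N powr (1 / 4 + \<eta>) * real N powr \<eta>"
      using N by (intro mult_left_mono X) (linarith | simp)+
    also have "\<dots> = real N powr (1 / 4 + \<epsilon>)"
      by (simp add: powr_add[symmetric] \<eta>(2) add.commute)
    finally show ?thesis .
  qed
  then show "\<exists>N\<^sub>0::nat. \<forall>N::nat. N \<ge> N\<^sub>0 \<longrightarrow> real (h N) \<le> real N powr (1/4 + \<epsilon>)"
    by blast
qed

end
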